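(* Let $A\in\mathbb{R}^{m\times n}$ have full column rank, $B\in\mathbb{R}^{s\times n}$ with $\mathrm{rank}(B)=s$, $b\in\mathbb{R}^m$, $d\in\mathbb{R}^s$, and let $x$ be the unique solution of the equality constrained least squares (ELS) problem $\min_{x\in\mathbb{R}^n}\|b-Ax\|_2^2$ subject to $Bx=d$. Put $M=A^TA$, $N=BM^{-1}B^T$, $P=B^TN^{-1}BM^{-1}-I_n$, $r=b-Ax$, $\lambda=-(BB^T)^{-1}BA^Tr$. Let $L\in\mathbb{R}^{n\times k}$ with $\mathrm{rank}(L)=k$ and let $\Phi,\Psi,\beta,\vartheta,\xi_L$ be positive real numbers. Then the projected condition number of the ELS problem with the Frobenius norm on the data space and the 2-norm on $\mathbb{R}^k$ (defined in the context) equals each of the following two expressions (in the second, $x\ne0$ is understood so that $\mathcal{P}_x$ is defined): $$\kappa_{2L\mathcal{F}els1}(A,B,b,d)=\xi_L\left\|L^T\mathcal{M}_{pa\mathcal{F}}\mathcal{M}_{pa\mathcal{F}}^TL\right\|_2^{1/2},$$ $$\kappa_{2L\mathcal{F}els2}(A,B,b,d)=\xi_L\left\|L^T\begin{bmatrix}M^{-1}P\mathcal{Q}, & \frac{\gamma}{\Psi\vartheta}M^{-1}B^TN^{-1}+\frac{\vartheta}{\Psi\gamma}M^{-1}Px\lambda^T\end{bmatrix}\right\|_2,$$ where $$\mathcal{M}_{pa\mathcal{F}}\mathcal{M}_{pa\mathcal{F}}^T=M^{-1}PSP^TM^{-1}+\tfrac{1}{\Psi^2}M^{-1}Px\lambda^TN^{-1}BM^{-1}+\tfrac{1}{\Psi^2}M^{-1}B^TN^{-1}\lambda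 x^TP^TM^{-1}+\tfrac{\gamma^2}{\Psi^2\vartheta^2}M^{-1}B^TN^{-2}BM^{-1},$$ $$\mathcal{Q}=\begin{bmatrix}\frac{\zeta}{\Phi\beta}A^T, & \frac{\|r\|_2}{\Phi}I_n, & \frac{\|\lambda\|_2}{\gamma}I_n, & \frac{\vartheta\|\lambda\|_2\|x\|_2}{\gamma\Psi}\mathcal{P}_x\end{bmatrix},$$ $\zeta=\sqrt{\beta^2\|x\|_2^2+\Phi^2}$, $\gamma=\sqrt{\vartheta^2\|x\|_2^2+\Psi^2}$, $S=\left(\frac{\|\lambda\|_2^2}{\Psi^2}+\frac{\|r\|_2^2}{\Phi^2}\right)I_n+\frac{\zeta^2}{\beta^2\Phi^2}A^TA$, and $\mathcal{P}_x=I_n-\frac{1}{\|x\|_2^2}xx^T$.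
   Context: $\|\cdot\|_2$ is the Euclidean/spectral norm. The solution map near the data is $\mathcal{F}(A,B,b,d)=x=M^{-1}B^TN^{-1}d-P^TM^{-1}A^Tb$, the unique solution of the ELS problem; $\mathcal{F}_L=L^T\mathcal{F}$. With $$\|\rho\circ\Delta\|_F=\sqrt{\Phi^2\|\Delta A\|_F^2+\Psi^2\|\Delta B\|_F^2+\beta^2\|\Delta b\|_2^2+\vartheta^2\|\Delta d\|_2^2},$$ the projected condition number in question is $$\lim_{\delta\to0^+}\ \sup_{0<\|\rho\circ\Delta\|_F\le\delta}\frac{\xi_L\|\mathcal{F}_L(A+\Delta A,B+\Delta B,b+\Delta b,d+\Delta d)-\mathcal{F}_L(A,B,b,d)\|_2}{\|\rho\circ\Delta\|_F}.$$ The symbol $\mathcal{M}_{pa\mathcal{F}}\mathcal{M}_{pa\mathcal{F}}^T$ may be read simply as the name of the $n\times n$ matrix displayed in the claim. *)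

theory Defs
  imports "HOL-Analysis.Analysis"
begin

(* Matrices in R^{m x n} have type real^'n^'m.  The norm that the library puts on this type is
   the square root of the sum of the squares of all entries, i.e. the Frobenius norm. *)

definition spectral_norm :: "real^'n^'m \<Rightarrow> real" where
  "spectral_norm A = onorm (\<lambda>v. A *v v)"

definition outer :: "real^'m \<Rightarrow> real^'n \<Rightarrow> real^'n^'m" where
  "outer u v = (\<chi> i j. u $ i * v $ j)"

(* The block row matrix [A, B]. *)
definition hcat :: "real^'a^'n \<Rightarrow> real^'b^'n \<Rightarrow> real^('a + 'b)^'n"  (infixr \<open>|||\<close> 60) where
  "A ||| B = (\<chi> i j. case j of Inl p \<Rightarrow> A $ i $ p | Inr q \<Rightarrow> B $ i $ q)"

definition is_els_solution ::
  "real^'n^'m \<Rightarrow> real^'n^'s \<Rightarrow> real^'m \<Rightarrow> real^'s \<Rightarrow> real^'n \<Rightarrow> bool" where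
  "is_els_solution A B b d x \<longleftrightarrow> is_arg_min (\<lambda>y. (norm (b - A *v y))\<^sup>2) (\<lambda>y. B *v y = d) x"

(* The solution map.  For data with rank A = n and rank B = s, in particular in a neighbourhood
   of such data, the solution exists, is unique, and is given by the closed form in
   els_solution_eq below.  For other data the value is unspecified (or the unique solution,
   if there is one); this does not affect the limit in els_projected_cond. *)
definition els_solution ::
  "real^'n^'m \<Rightarrow> real^'n^'s \<Rightarrow> real^'m \<Rightarrow> real^'s \<Rightarrow> real^'n" where
  "els_solution A B b d = (THE x. is_els_solution A B b d x)"

definition els_projected_solution ::
  "real^'k^'n \<Rightarrow> real^'n^'m \<Rightarrow> real^'n^'s \<Rightarrow> real^'m \<Rightarrow> real^'s \<Rightarrow> real^'k" where
  "els_projected_solution L A B b d = transpose L *v els_solution A B b d"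

definition weighted_norm ::
  "real \<Rightarrow> real \<Rightarrow> real \<Rightarrow> real \<Rightarrow>
   real^'n^'m \<Rightarrow> real^'n^'s \<Rightarrow> real^'m \<Rightarrow> real^'s \<Rightarrow> real" where
  "weighted_norm \<Phi> \<Psi> \<beta> \<theta> dA dB db dd =
     sqrt (\<Phi>\<^sup>2 * (norm dA)\<^sup>2 + \<Psi>\<^sup>2 * (norm dB)\<^sup>2 + \<beta>\<^sup>2 * (norm db)\<^sup>2 + \<theta>\<^sup>2 * (norm dd)\<^sup>2)"

(* The suprema are taken in the extended reals, because they may be infinite when the bound \<delta> on
   the perturbation is not small. *)
definition els_ratio_sup ::
  "real \<Rightarrow> real \<Rightarrow> real \<Rightarrow> real \<Rightarrow> real \<Rightarrow> real^'k^'n \<Rightarrow>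
   real^'n^'m \<Rightarrow> real^'n^'s \<Rightarrow> real^'m \<Rightarrow> real^'s \<Rightarrow> real \<Rightarrow> ereal" where
  "els_ratio_sup \<Phi> \<Psi> \<beta> \<theta> \<xi> L A B b d \<delta> =
     Sup {ereal (\<xi> * norm (els_projected_solution L (A + dA) (B + dB) (b + db) (d + dd)
                           - els_projected_solution L A B b d)
                 / weighted_norm \<Phi> \<Psi> \<beta> \<theta> dA dB db dd)
          | dA dB db dd.
            0 < weighted_norm \<Phi> \<Psi> \<beta> \<theta> dA dB db dd \<and> weighted_norm \<Phi> \<Psi> \<beta> \<theta> dA dB db dd \<le> \<delta>}"

(* By els_ratio_sup_tendsto below the limit always exists. *)
definition els_projected_cond ::
  "real \<Rightarrow> real \<Rightarrow> real \<Rightarrow> real \<Rightarrow> real \<Rightarrow> real^'k^'n \<Rightarrow>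
   real^'n^'m \<Rightarrow> real^'n^'s \<Rightarrow> real^'m \<Rightarrow> real^'s \<Rightarrow> ereal" where
  "els_projected_cond \<Phi> \<Psi> \<beta> \<theta> \<xi> L A B b d =
     Lim (at_right 0) (els_ratio_sup \<Phi> \<Psi> \<beta> \<theta> \<xi> L A B b d)"

lemma els_ratio_sup_mono:
  "\<delta> \<le> \<delta>' \<Longrightarrow> els_ratio_sup \<Phi> \<Psi> \<beta> \<theta> \<xi> L A B b d \<delta> \<le> els_ratio_sup \<Phi> \<Psi> \<beta> \<theta> \<xi> L A B b d \<delta>'"
  unfolding els_ratio_sup_def by (rule Sup_subset_mono) force

lemma els_ratio_sup_tendsto:
  "(els_ratio_sup \<Phi> \<Psi> \<beta> \<theta> \<xi> L A B b d \<longlongrightarrow> els_projected_cond \<Phi> \<Psi> \<beta> \<theta> \<xi> L A B b d) (at_right 0)"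
proof -
  let ?f = "els_ratio_sup \<Phi> \<Psi> \<beta> \<theta> \<xi> L A B b d"
  have "(?f \<longlongrightarrow> Inf (?f ` {0<..})) (at_right 0)"
  proof (rule order_tendstoI)
    fix a assume a: "a < Inf (?f ` {0<..})"
    have "a < ?f y" if "y > 0" for y
      using a that by (meson INF_lower greaterThan_iff less_le_trans)
    then show "eventually (\<lambda>y. a < ?f y) (at_right 0)"
      by (auto intro: eventually_mono[OF eventually_at_right_less])
  next
    fix a assume "Inf (?f ` {0<..}) < a"
    then obtain e where e: "e > 0" "?f e < a" by (auto simp: Inf_less_iff)
    have "?f y < a" if "y < e" for y
      using e(2) els_ratio_sup_mono[of y e] that by (meson le_less_trans less_imp_le)
    then show "eventually (\<lambda>y. ?f y < a) (at_right 0)"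
      using e(1) by (auto simp: eventually_at_right_field)
  qed
  then show ?thesis
    unfolding els_projected_cond_def by (simp add: tendsto_Lim)
qed

lemma matrix_inv_cancel:
  fixes X :: "real^'q^'q"
  assumes "invertible X"
  shows "X ** matrix_inv X = mat 1" and "matrix_inv X ** X = mat 1"
proof -
  have "X ** matrix_inv X = mat 1 \<and> matrix_inv X ** X = mat 1"
    using assms unfolding invertible_def matrix_inv_def by (rule someI_ex)
  then show "X ** matrix_inv X = mat 1" and "matrix_inv X ** X = mat 1" by auto
qed

lemma inner_transpose: "(A *v u) \<bullet> v = u \<bullet> (transpose A *v v)"
  for A :: "real^'n^'m"
  by (simp add: transpose_matrix_vector inner_commute[of u] dot_lmul_matrix inner_commute[of v])

lemma matrix_symmetric_inv:
  fixes X :: "real^'q^'q"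
  assumes X: "invertible X" and s: "transpose X = X"
  shows "transpose (matrix_inv X) = matrix_inv X"
proof -
  have "transpose (matrix_inv X) ** X = mat 1"
    using arg_cong[OF matrix_inv_cancel(1)[OF X], of transpose]
    by (simp add: matrix_transpose_mul s transpose_mat)
  then have "transpose (matrix_inv X) ** (X ** matrix_inv X) = matrix_inv X"
    by (simp add: matrix_mul_assoc)
  then show ?thesis by (simp add: matrix_inv_cancel[OF X])
qed

lemma invertible_ker:
  fixes X :: "real^'q^'q"
  assumes "\<And>v. X *v v = 0 \<Longrightarrow> v = 0"
  shows "invertible X"
  unfolding invertible_left_inverse using assms matrix_left_invertible_ker[of X] by blast

lemma inj_matrix_ker:
  fixes X :: "real^'n^'m"
  shows "inj ((*v) X) \<Longrightarrow> X *v v = 0 \<Longrightarrow> v = 0"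
  by (rule injD[of "(*v) X"]) simp_all

lemma gram_invertible:
  fixes A :: "real^'n^'m"
  assumes "rank A = CARD('n)"
  shows "invertible (transpose A ** A)"
proof -
  have inj: "inj ((*v) A)" using assms by (simp add: full_rank_injective)
  have "v = 0" if "(transpose A ** A) *v v = 0" for v
  proof -
    have "(A *v v) \<bullet> (A *v v) = v \<bullet> ((transpose A ** A) *v v)"
      by (simp add: inner_transpose matrix_vector_mul_assoc)
    then have "A *v v = 0" using that by simp
    then show ?thesis using inj inj_matrix_ker by blast
  qed
  then show ?thesis
    by (rule invertible_ker)
qed

lemma schur_invertible:
  fixes A :: "real^'n^'m" and B :: "real^'n^'s"
  assumes A: "rank A = CARD('n)" and B: "rank B = CARD('s)"
  shows "invertible (B ** matrix_inv (transpose A ** A) ** transpose B)"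
proof -
  let ?M = "transpose A ** A"
  have M: "?M ** matrix_inv ?M = mat 1"
    using gram_invertible[OF A] by (simp add: matrix_inv_cancel)
  have injB: "inj ((*v) (transpose B))"
    using B by (simp add: full_rank_injective[symmetric] rank_transpose)
  have injA: "inj ((*v) A)" using A by (simp add: full_rank_injective)
  have "w = 0" if w: "(B ** matrix_inv ?M ** transpose B) *v w = 0" for w
  proof -
    define u where "u = matrix_inv ?M *v (transpose B *v w)"
    have Mu: "?M *v u = transpose B *v w"
      by (simp add: u_def matrix_vector_mul_assoc M)
    have "(A *v u) \<bullet> (A *v u) = (?M *v u) \<bullet> u"
      by (simp add: inner_transpose matrix_vector_mul_assoc inner_commute)
    also have "\<dots> = w \<bullet> (B *v u)"
      by (simp add: Mu dot_lmul_matrix)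
    also have "B *v u = 0" using w by (simp add: u_def matrix_vector_mul_assoc matrix_mul_assoc del: transpose_matrix_vector)
    finally have "A *v u = 0" by simp
    then have "u = 0" by (rule inj_matrix_ker[OF injA])
    then have "transpose B *v w = 0" using Mu by simp
    then show ?thesis by (rule inj_matrix_ker[OF injB])
  qed
  then show ?thesis
    by (rule invertible_ker)
qed

lemma els_solution_eq:
  fixes A :: "real^'n^'m" and B :: "real^'n^'s"
  assumes A: "rank A = CARD('n)" and B: "rank B = CARD('s)"
    and M: "M = transpose A ** A"
    and N: "N = B ** matrix_inv M ** transpose B"
    and P: "P = transpose B ** matrix_inv N ** B ** matrix_inv M - mat 1"
    and x: "x = matrix_inv M ** transpose B ** matrix_inv N *v d
                - transpose P ** matrix_inv M ** transpose A *v b"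
  shows "is_els_solution A B b d y \<longleftrightarrow> y = x" and "els_solution A B b d = x"
proof -
  have iM: "invertible M" unfolding M by (rule gram_invertible[OF A])
  have iN: "invertible N" unfolding N M by (rule schur_invertible[OF A B])
  have MM: "M ** matrix_inv M = mat 1" using iM by (simp add: matrix_inv_cancel)
  have NN: "N ** matrix_inv N = mat 1" using iN by (simp add: matrix_inv_cancel)
  have tM: "transpose (matrix_inv M) = matrix_inv M"
    by (rule matrix_symmetric_inv[OF iM]) (simp add: M matrix_transpose_mul)
  have tN: "transpose (matrix_inv N) = matrix_inv N"
    by (rule matrix_symmetric_inv[OF iN]) (simp add: N matrix_transpose_mul tM matrix_mul_assoc)
  define c where "c = matrix_inv M *v (transpose A *v b)"
  have tdiff: "transpose (X - Y) = transpose X - transpose Y" for X Y :: "real^'n^'n"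
    by (simp add: transpose_def vec_eq_iff)
  have tP: "transpose P = matrix_inv M ** transpose B ** matrix_inv N ** B - mat 1"
    by (simp add: P tdiff matrix_transpose_mul tM tN transpose_mat matrix_mul_assoc)
  have x': "x = c + matrix_inv M *v (transpose B *v (matrix_inv N *v (d - B *v c)))"
    by (simp add: x tP c_def matrix_vector_mul_assoc[symmetric] matrix_vector_mult_diff_rdistrib
        matrix_vector_mult_diff_distrib)
  have Bx: "B *v x = d"
  proof -
    have "B *v x = B *v c + N *v (matrix_inv N *v (d - B *v c))"
      by (simp add: x' N matrix_vector_mul_assoc[symmetric] matrix_vector_right_distrib)
    also have "N *v (matrix_inv N *v (d - B *v c)) = d - B *v c"
      by (simp add: matrix_vector_mul_assoc NN)
    finally show ?thesis by simp
  qed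
  have Mc: "M *v (matrix_inv M *v v) = v" for v
    by (simp add: matrix_vector_mul_assoc MM)
  define l where "l = matrix_inv N *v (d - B *v c)"
  have Mx: "M *v x = transpose A *v b + transpose B *v l"
    by (simp add: x' c_def l_def matrix_vector_right_distrib Mc)
  have key: "(norm (b - A *v z))\<^sup>2 = (norm (b - A *v x))\<^sup>2 + (norm (A *v (x - z)))\<^sup>2"
    if z: "B *v z = d" for z
  proof -
    have "(b - A *v x) \<bullet> (A *v (x - z)) = (transpose A *v (b - A *v x)) \<bullet> (x - z)"
      by (simp add: dot_lmul_matrix)
    also have "transpose A *v (b - A *v x) = - (transpose B *v l)"
      using Mx by (simp add: M matrix_vector_mult_diff_distrib matrix_vector_mul_assoc[symmetric])
    also have "(- (transpose B *v l)) \<bullet> (x - z) = - (l \<bullet> (B *v (x - z)))"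
      by (simp add: dot_lmul_matrix)
    also have "\<dots> = 0" by (simp add: matrix_vector_mult_diff_distrib Bx z)
    finally have 0: "(b - A *v x) \<bullet> (A *v (x - z)) = 0" .
    have "b - A *v z = (b - A *v x) + A *v (x - z)"
      by (simp add: matrix_vector_mult_diff_distrib)
    then show ?thesis
      using 0 by (metis norm_add_Pythagorean orthogonal_def)
  qed
  have injA: "inj ((*v) A)" using A by (simp add: full_rank_injective)
  have iff: "is_els_solution A B b d z \<longleftrightarrow> z = x" for z
  proof
    assume "is_els_solution A B b d z"
    then have z: "B *v z = d" and le: "\<not> (norm (b - A *v x))\<^sup>2 < (norm (b - A *v z))\<^sup>2"
      using Bx by (auto simp: is_els_solution_def is_arg_min_def)
    then have "A *v (x - z) = 0" using key[OF z] by simp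
    then have "x - z = 0" by (rule inj_matrix_ker[OF injA])
    then show "z = x" by simp
  next
    assume z: "z = x"
    have "\<not> (norm (b - A *v y))\<^sup>2 < (norm (b - A *v x))\<^sup>2" if "B *v y = d" for y
      using key[OF that] zero_le_power2[of "norm (A *v (x - y))"] by linarith
    then show "is_els_solution A B b d z"
      unfolding is_els_solution_def is_arg_min_def z using Bx by blast
  qed
  show "is_els_solution A B b d y \<longleftrightarrow> y = x" by (rule iff)
  show "els_solution A B b d = x" unfolding els_solution_def iff by simp
qed

end

(* The solution x and its multiplier l solve the KKT system with matrix [[M, -B^T], [B, 0]], and
   this is a linear equation whose coefficients are smooth in the data.  Differentiating it
   implicitly gives dx = G (dd - dB x) - K (dA^T r - A^T (dA x - db) + dB^T l) with K = M^-1 P and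
   G = M^-1 B^T N^-1.  The condition number is xi times the operator norm of L^T dx in the rescaled
   data, and that norm is the norm of the adjoint.  The squared norm of the adjoint at y is a
   quadratic form in z = L y; its only unwanted term contains (A K z) . r = -(B K z) . l, which
   vanishes because B K = 0.  What remains is z . W z, and it is also the squared norm of the
   transpose of the block row matrix applied to z. *)
theory Submission
  imports Defs
begin

section \<open>Implicit differentiation of a parametrised linear equation\<close>

text \<open>Comparing the equations at \<open>u\<close> and at \<open>p\<close> shows that
  \<open>op (H p)\<close> maps the linearisation error to a remainder of order o(|u - p|) plus a
  term that is small relative to the increment of \<open>z\<close>. Injectivity of
  \<open>op (H p)\<close> bounds the error from below, so the second term can be absorbed;
  continuity of \<open>z\<close> at \<open>p\<close> comes out of the same estimate.\<close>

lemma implicit_linear_has_derivative: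
  fixes op :: "'h::real_normed_vector \<Rightarrow> 'z::euclidean_space \<Rightarrow> 'w::euclidean_space"
    and H :: "'p::real_normed_vector \<Rightarrow> 'h"
  assumes op: "bounded_bilinear op"
    and H: "(H has_derivative H') (at p)"
    and q: "(q has_derivative q') (at p)"
    and z: "eventually (\<lambda>u. op (H u) (z u) = q u) (nhds p)"
    and inj: "\<And>v. op (H p) v = 0 \<Longrightarrow> v = 0"
    and J: "\<And>h. op (H p) (J h) = q' h - op (H' h) (z p)"
  shows "(z has_derivative J) (at p)"
proof -
  interpret op: bounded_bilinear op by (rule op)
  define e where "e u = q u - op (H u) (z p)" for u
  define e' where "e' h = q' h - op (H' h) (z p)" for h
  have linH: "linear (op (H p))"
    using op.bounded_linear_right bounded_linear.linear by blast
  have "inj (op (H p))"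
    using linear_injective_0[OF linH] inj by blast
  with linH obtain c where c: "c > 0" "\<And>v. c * norm v \<le> norm (op (H p) v)"
    by (metis linear_inj_bounded_below_pos mult.commute)
  obtain K where K: "K > 0" "\<And>a b. norm (op a b) \<le> norm a * norm b * K"
    using op.pos_bounded by blast
  have e: "(e has_derivative e') (at p)"
    unfolding e_def e'_def
    using has_derivative_diff[OF q op.FDERIV[OF H has_derivative_const[of "z p"]]]
    by (simp add: op.zero_right)
  then interpret e': bounded_linear e' by (rule has_derivative_bounded_linear)
  have HJ: "op (H p) (J h) = e' h" for h by (simp add: J e'_def)
  have injD: "v = w" if "op (H p) v = op (H p) w" for v w
    using inj[of "v - w"] that by (simp add: op.diff_right)
  obtain E where E: "\<And>h. norm (e' h) \<le> norm h * E" "E > 0" using e'.pos_bounded by blast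
  have J_bound: "norm (J h) \<le> norm h * (E / c)" for h
    using order_trans[OF c(2)[of "J h"] ] E(1)[of h] c(1) by (simp add: HJ field_simps)
  \<comment> \<open>\<open>J\<close> is given only through the equation it solves: injectivity of
    \<open>op (H p)\<close> makes it linear, and the lower bound \<open>c\<close> makes it
    bounded.\<close>
  have blJ: "bounded_linear J"
    by (rule bounded_linear_intro[of _ "E / c"])
      (auto intro!: injD simp: HJ op.add_right op.scaleR_right e'.add e'.scaleR J_bound[simplified])
  \<comment> \<open>The filter \<open>nhds p\<close> includes the point \<open>p\<close>, so the
    equation holds there as well.\<close>
  have ep: "e p = 0"
    using eventually_nhds_x_imp_x[OF z] by (simp add: e_def)
  have e_lim: "((\<lambda>u. norm (e u - e' (u - p)) / norm (u - p)) \<longlongrightarrow> 0) (at p)"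
    using e by (simp add: has_derivative_iff_norm ep)
  have "((\<lambda>u. norm (H u - H p) * K) \<longlongrightarrow> norm (H p - H p) * K) (at p)"
    using has_derivative_continuous[OF H] by (intro tendsto_intros) (simp add: continuous_within)
  then have H_lim: "((\<lambda>u. norm (H u - H p) * K) \<longlongrightarrow> 0) (at p)" by simp
  define R where "R u = norm (e u - e' (u - p)) / norm (u - p) + norm (H u - H p) * K * (E / c)" for u
  have "((\<lambda>u. 2 / c * R u) \<longlongrightarrow> 2 / c * (0 + 0 * (E / c))) (at p)"
    unfolding R_def by (intro tendsto_intros e_lim H_lim)
  then have R_lim: "((\<lambda>u. 2 / c * R u) \<longlongrightarrow> 0) (at p)" by simp
  \<comment> \<open>Below \<open>c / 2\<close>, moving this term to the left leaves half of
    \<open>c * norm (w - j)\<close>; hence the factor \<open>2 / c\<close> in front of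
    \<open>R\<close>.\<close>
  have small: "eventually (\<lambda>u. norm (H u - H p) * K < c / 2) (at p)"
    using order_tendstoD(2)[OF H_lim, of "c / 2"] c(1) by simp
  have est: "norm (z u - z p - J (u - p)) / norm (u - p) \<le> 2 / c * R u"
    if zu: "op (H u) (z u) = q u" and su: "norm (H u - H p) * K < c / 2" and "u \<noteq> p" for u
  proof -
    define w where "w = z u - z p"
    define j where "j = J (u - p)"
    have "op (H p) (w - j) = (e u - e' (u - p)) - op (H u - H p) w"
      using zu by (simp add: w_def j_def op.diff_right op.diff_left HJ e_def)
    then have "c * norm (w - j) \<le> norm ((e u - e' (u - p)) - op (H u - H p) w)"
      by (metis c(2))
    also have "\<dots> \<le> norm (e u - e' (u - p)) + norm (op (H u - H p) w)"
      by (rule norm_triangle_ineq4)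
    also have "norm (op (H u - H p) w) \<le> norm (H u - H p) * K * norm w"
      using K(2)[of "H u - H p" w] by (simp add: ac_simps)
    also have "\<dots> \<le> norm (H u - H p) * K * (norm (w - j) + norm j)"
      using K(1) by (intro mult_left_mono norm_triangle_sub[of w j, THEN order_trans]) auto
    also have "\<dots> \<le> c / 2 * norm (w - j) + norm (H u - H p) * K * (norm (u - p) * (E / c))"
      unfolding distrib_left
      using su K(1) J_bound[of "u - p"] c(1) by (intro add_mono mult_mono) (auto simp: j_def)
    finally have "c / 2 * norm (w - j) \<le> norm (e u - e' (u - p)) + norm (H u - H p) * K * (norm (u - p) * (E / c))"
      by (simp add: field_simps)
    also have "\<dots> = R u * norm (u - p)"
      using \<open>u \<noteq> p\<close> by (simp add: R_def distrib_right)
    finally have "norm (w - j) \<le> 2 / c * R u * norm (u - p)"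
      using c(1) by (simp add: field_simps)
    then show ?thesis
      using \<open>u \<noteq> p\<close> by (simp add: w_def j_def pos_divide_le_eq)
  qed
  have "eventually (\<lambda>u. op (H u) (z u) = q u) (at p)"
    using z by (simp add: eventually_nhds_conv_at)
  with small have "eventually (\<lambda>u. norm (z u - z p - J (u - p)) / norm (u - p) \<le> 2 / c * R u) (at p)"
    using eventually_neq_at_within[of p p UNIV] by eventually_elim (rule est)
  then have "((\<lambda>u. norm (z u - z p - J (u - p)) / norm (u - p)) \<longlongrightarrow> 0) (at p)"
    by (intro tendsto_sandwich[OF _ _ tendsto_const R_lim]) auto
  with blJ show ?thesis by (simp add: has_derivative_iff_norm)
qed

section \<open>Difference quotients and the operator norm of the derivative\<close>

text \<open>The quotients of \<open>g\<close> and of \<open>J\<close> differ by o(1) uniformly in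
  the direction of \<open>u\<close>, and the quotient of \<open>J\<close> is invariant under
  scaling, so every small ball already sees all of \<open>onorm J\<close>. The class
  \<open>perfect_space\<close> provides nonzero \<open>u\<close>; in a trivial space the supremum
  would be that of the empty set.\<close>

lemma ratio_Sup_tendsto_onorm:
  fixes g :: "'a::{real_normed_vector, perfect_space} \<Rightarrow> 'b::real_normed_vector"
  assumes g: "(g has_derivative J) (at 0)"
  shows "((\<lambda>\<delta>. Sup {ereal (norm (g u - g 0) / norm u) | u. 0 < norm u \<and> norm u \<le> \<delta>})
           \<longlongrightarrow> ereal (onorm J)) (at_right 0)"
proof -
  let ?Q = "\<lambda>u. norm (g u - g 0) / norm u"
  interpret J: bounded_linear J using g by (rule has_derivative_bounded_linear)
  have near: "\<exists>d>0. \<forall>u. u \<noteq> 0 \<and> norm u < d \<longrightarrow> \<bar>?Q u - norm (J u) / norm u\<bar> < e"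
    if "e > 0" for e
  proof -
    have "((\<lambda>u. norm (g u - g 0 - J u) / norm u) \<longlongrightarrow> 0) (at 0)"
      using g by (simp add: has_derivative_iff_norm)
    from tendstoD[OF this that]
    obtain d where d: "d > 0" "\<And>u. u \<noteq> 0 \<Longrightarrow> norm u < d \<Longrightarrow> norm (g u - g 0 - J u) / norm u < e"
      by (auto simp: eventually_at dist_norm)
    have "\<bar>?Q u - norm (J u) / norm u\<bar> \<le> norm (g u - g 0 - J u) / norm u" for u
      using norm_triangle_ineq3[of "g u - g 0" "J u"]
      by (simp add: diff_divide_distrib[symmetric] divide_right_mono)
    with d show ?thesis by (meson le_less_trans)
  qed
  show ?thesis
  proof (rule order_tendstoI)
    fix a assume "a < ereal (onorm J)"
    then obtain a' where a': "a < ereal a'" "a' < onorm J"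
      using ereal_dense2 by force
    then obtain u where u: "a' * norm u < norm (J u)"
      by (meson onorm_le not_less)
    then have u0: "u \<noteq> 0" by auto
    define e where "e = norm (J u) / norm u - a'"
    have "e > 0" using u u0 by (simp add: e_def field_simps)
    then obtain d where d: "d > 0" "\<And>u. u \<noteq> 0 \<Longrightarrow> norm u < d \<Longrightarrow> \<bar>?Q u - norm (J u) / norm u\<bar> < e"
      using near by blast
    have "a < Sup {ereal (?Q u) | u. 0 < norm u \<and> norm u \<le> \<delta>}" if "\<delta> > 0" for \<delta>
    proof -
      \<comment> \<open>The rescaled \<open>u\<close> has length at most \<open>\<delta>\<close>, so
        it is admissible, and below \<open>d\<close>, so \<open>near\<close> applies to it.\<close>
      define t where "t = min \<delta> (d / 2) / norm u"
      have t: "t > 0" using that d(1) u0 by (simp add: t_def)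
      have nt: "norm (t *\<^sub>R u) = min \<delta> (d / 2)" using that d(1) u0 by (simp add: t_def)
      have "\<bar>?Q (t *\<^sub>R u) - norm (J (t *\<^sub>R u)) / norm (t *\<^sub>R u)\<bar> < e"
        using d t u0 nt by (intro d(2)) auto
      moreover have "norm (J (t *\<^sub>R u)) / norm (t *\<^sub>R u) = norm (J u) / norm u"
        using t by (simp add: J.scaleR)
      ultimately have "a' < ?Q (t *\<^sub>R u)" unfolding e_def by linarith
      then have "a < ereal (?Q (t *\<^sub>R u))" using a'(1) by (metis less_ereal.simps(1) less_trans)
      moreover have "ereal (?Q (t *\<^sub>R u)) \<in> {ereal (?Q u) | u. 0 < norm u \<and> norm u \<le> \<delta>}"
        using t u0 nt that d(1) by (intro CollectI exI[of _ "t *\<^sub>R u"]) (simp del: norm_scaleR)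
      ultimately show ?thesis by (rule less_Sup_iff[THEN iffD2, OF bexI])
    qed
    then show "eventually (\<lambda>\<delta>. a < Sup {ereal (?Q u) | u. 0 < norm u \<and> norm u \<le> \<delta>}) (at_right 0)"
      by (auto intro: eventually_mono[OF eventually_at_right_less])
  next
    fix a assume "ereal (onorm J) < a"
    then obtain a' where a': "ereal a' < a" "onorm J < a'"
      using ereal_dense2 by force
    then obtain d where d: "d > 0"
      "\<And>u. u \<noteq> 0 \<Longrightarrow> norm u < d \<Longrightarrow> \<bar>?Q u - norm (J u) / norm u\<bar> < a' - onorm J"
      using near[of "a' - onorm J"] by auto
    have "Sup {ereal (?Q u) | u. 0 < norm u \<and> norm u \<le> \<delta>} < a" if "\<delta> < d" for \<delta>
    proof -
      have "?Q u \<le> a'" if "0 < norm u" "norm u \<le> \<delta>" for u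
        using d(2)[of u] le_onorm[OF J.bounded_linear_axioms, of u] that \<open>\<delta> < d\<close> by auto
      then have "Sup {ereal (?Q u) | u. 0 < norm u \<and> norm u \<le> \<delta>} \<le> ereal a'"
        by (auto intro!: Sup_least)
      with a'(1) show ?thesis by simp
    qed
    then show "eventually (\<lambda>\<delta>. Sup {ereal (?Q u) | u. 0 < norm u \<and> norm u \<le> \<delta>} < a) (at_right 0)"
      using d(1) by (auto simp: eventually_at_right_field)
  qed
qed

section \<open>Operator norms of adjoints and of Gram operators\<close>

text \<open>Cauchy-Schwarz on |h u|^2 = u . h* (h u) bounds the norm of \<open>h\<close> by that of
  its adjoint; since taking adjoints is involutive, this one inequality suffices.\<close>

lemma onorm_adjoint:
  fixes f :: "'a::euclidean_space \<Rightarrow> 'b::euclidean_space"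
  assumes f: "linear f"
  shows "onorm (adjoint f) = onorm f"
proof -
  have le: "onorm h \<le> onorm (adjoint h)" if h: "linear h"
    for h :: "'c::euclidean_space \<Rightarrow> 'd::euclidean_space"
  proof (rule onorm_le)
    fix u
    have bl: "bounded_linear (adjoint h)"
      using adjoint_linear[OF h] by (simp add: linear_conv_bounded_linear)
    have "(norm (h u))\<^sup>2 = u \<bullet> adjoint h (h u)"
      by (simp add: power2_norm_eq_inner adjoint_works[OF h])
    also have "\<dots> \<le> norm u * (onorm (adjoint h) * norm (h u))"
      using norm_cauchy_schwarz onorm[OF bl] by (meson order_trans mult_left_mono norm_ge_zero)
    finally have "norm (h u) * norm (h u) \<le> (onorm (adjoint h) * norm u) * norm (h u)"
      by (simp add: power2_eq_square ac_simps)
    then show "norm (h u) \<le> onorm (adjoint h) * norm u"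
      by (cases "norm (h u) = 0") (auto simp: onorm_pos_le[OF bl])
  qed
  show ?thesis
    using le[OF adjoint_linear[OF f]] le[OF f] by (simp add: adjoint_adjoint[OF f])
qed

text \<open>\<open>W\<close> is the Gram operator g* g, recognised from its quadratic form alone:
  polarisation recovers \<open>g y \<bullet> g v = y \<bullet> W v\<close>, and both inequalities
  follow by Cauchy-Schwarz.\<close>

lemma onorm_symmetric_square:
  fixes W :: "'a::euclidean_space \<Rightarrow> 'a" and g :: "'a \<Rightarrow> 'b::real_inner"
  assumes W: "linear W" and g: "bounded_linear g"
    and sym: "\<And>y v. W y \<bullet> v = y \<bullet> W v"
    and sq: "\<And>y. (norm (g y))\<^sup>2 = y \<bullet> W y"
  shows "onorm W = (onorm g)\<^sup>2"
proof (rule antisym)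
  interpret g: bounded_linear g by (rule g)
  have blW: "bounded_linear W" using W by (simp add: linear_conv_bounded_linear)
  have polar: "g y \<bullet> g v = y \<bullet> W v" for y v
    using sq[of "y + v"] sq[of y] sq[of v] sym[of v y]
    by (simp add: g.add linear_add[OF W] power2_norm_eq_inner inner_simps inner_commute)
  show "onorm W \<le> (onorm g)\<^sup>2"
  proof (rule onorm_le)
    fix v
    have "(norm (W v))\<^sup>2 = g (W v) \<bullet> g v" by (simp add: power2_norm_eq_inner polar)
    also have "\<dots> \<le> norm (g (W v)) * norm (g v)" by (rule norm_cauchy_schwarz)
    also have "\<dots> \<le> (onorm g * norm (W v)) * (onorm g * norm v)"
      by (intro mult_mono onorm[OF g] mult_nonneg_nonneg onorm_pos_le[OF g]) auto
    finally have "norm (W v) * norm (W v) \<le> ((onorm g)\<^sup>2 * norm v) * norm (W v)"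
      by (simp add: power2_eq_square ac_simps)
    then show "norm (W v) \<le> (onorm g)\<^sup>2 * norm v"
      by (cases "norm (W v) = 0") auto
  qed
  have "onorm g \<le> sqrt (onorm W)"
  proof (rule onorm_le)
    fix y
    have "(norm (g y))\<^sup>2 \<le> norm y * norm (W y)" by (simp add: sq norm_cauchy_schwarz)
    also have "\<dots> \<le> norm y * (onorm W * norm y)" by (intro mult_left_mono onorm[OF blW]) auto
    finally have "(norm (g y))\<^sup>2 \<le> (sqrt (onorm W) * norm y)\<^sup>2"
      by (simp add: power_mult_distrib onorm_pos_le[OF blW] power2_eq_square ac_simps)
    then show "norm (g y) \<le> sqrt (onorm W) * norm y"
      by (rule power2_le_imp_le) (simp add: onorm_pos_le[OF blW])
  qed
  then have "(onorm g)\<^sup>2 \<le> (sqrt (onorm W))\<^sup>2"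
    using onorm_pos_le[OF g] by (intro power_mono)
  then show "(onorm g)\<^sup>2 \<le> onorm W" by (simp add: onorm_pos_le[OF blW])
qed

section \<open>Matrix products as bilinear maps, and openness of full rank\<close>

declare transpose_matrix_vector [simp del]

lemma transpose_add: "transpose (X + Y) = transpose X + transpose Y"
  for X Y :: "real^'n^'m"
  by (simp add: transpose_def vec_eq_iff)

lemma transpose_diff: "transpose (X - Y) = transpose X - transpose Y"
  for X Y :: "real^'n^'m"
  by (simp add: transpose_def vec_eq_iff)

lemma bounded_linear_transpose: "bounded_linear (transpose :: real^'n^'m \<Rightarrow> real^'m^'n)"
  by (simp add: linear_conv_bounded_linear[symmetric] linear_iff transpose_add transpose_scalar)

lemma matrix_mult_add_left: "(X + Y) ** Z = X ** Z + Y ** Z"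
  for X Y :: "real^'n^'m"
  by (simp add: matrix_matrix_mult_def vec_eq_iff distrib_right sum.distrib)

lemma bounded_bilinear_matrix_mult:
  "bounded_bilinear ((**) :: real^'n^'m \<Rightarrow> real^'k^'n \<Rightarrow> real^'k^'m)"
  by (simp add: bilinear_conv_bounded_bilinear[symmetric] bilinear_def linear_iff
      matrix_add_ldistrib matrix_mult_add_left matrix_scalar_ac scalar_matrix_assoc
      flip: scalar_mult_eq_scaleR)

lemma bounded_bilinear_matrix_vector_mult:
  "bounded_bilinear ((*v) :: real^'n^'m \<Rightarrow> real^'n \<Rightarrow> real^'m)"
  by (simp add: bilinear_conv_bounded_bilinear[symmetric] bilinear_def linear_iff
      algebra_simps scaleR_matrix_vector_assoc[symmetric])

text \<open>Expresses full rank by the nonvanishing of a continuous function of the entries, so that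
  it persists under small perturbations.\<close>

lemma rank_eq_ncols_iff: "rank X = CARD('n) \<longleftrightarrow> det (transpose X ** X) \<noteq> 0"
  for X :: "real^'n^'m"
proof
  show "det (transpose X ** X) \<noteq> 0" if "rank X = CARD('n)"
    using gram_invertible[OF that] by (simp add: invertible_det_nz)
next
  assume "det (transpose X ** X) \<noteq> 0"
  then have inv: "invertible (transpose X ** X)" by (simp add: invertible_det_nz)
  have "v = 0" if "X *v v = 0" for v
  proof -
    have "(transpose X ** X) *v v = 0" using that by (simp add: matrix_vector_mul_assoc[symmetric])
    then show ?thesis
      using matrix_inv_cancel(2)[OF inv] by (metis matrix_vector_mul_assoc matrix_vector_mul_lid matrix_vector_mult_0_right)
  qed
  then show "rank X = CARD('n)"
    by (simp add: full_rank_injective linear_injective_0)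
qed

lemma tendsto_det: "(f \<longlongrightarrow> X) F \<Longrightarrow> ((\<lambda>u. det (f u)) \<longlongrightarrow> det X) F"
  for X :: "real^'n^'n"
  unfolding det_def by (intro tendsto_intros)

lemma eventually_full_col_rank:
  fixes X :: "real^'n^'m"
  assumes f: "(f \<longlongrightarrow> X) F" and X: "rank X = CARD('n)"
  shows "eventually (\<lambda>u. rank (f u) = CARD('n)) F"
proof -
  have "((\<lambda>u. det (transpose (f u) ** f u)) \<longlongrightarrow> det (transpose X ** X)) F"
    by (intro tendsto_det bounded_bilinear.tendsto[OF bounded_bilinear_matrix_mult]
        bounded_linear.tendsto[OF bounded_linear_transpose] f)
  then show ?thesis
    using X unfolding rank_eq_ncols_iff by (rule tendsto_imp_eventually_ne)
qed

lemma eventually_full_row_rank: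
  fixes X :: "real^'n^'m"
  assumes f: "(f \<longlongrightarrow> X) F" and X: "rank X = CARD('m)"
  shows "eventually (\<lambda>u. rank (f u) = CARD('m)) F"
  using eventually_full_col_rank[OF bounded_linear.tendsto[OF bounded_linear_transpose f]] X
  by (simp add: rank_transpose)

section \<open>The KKT system and the derivative of the solution map\<close>

text \<open>The closed form is the unconstrained least squares solution \<open>c\<close> plus the
  correction M^-1 B^T w. The multiplier \<open>w\<close> is determined by the constraint: since
  \<open>B\<close> maps the correction to \<open>N *v w\<close>, it must equal N^-1 (d - B
  c).\<close>

lemma els_solution_kkt:
  fixes A :: "real^'n^'m" and B :: "real^'n^'s"
  assumes A: "rank A = CARD('n)" and B: "rank B = CARD('s)"
  shows "\<exists>w. transpose A ** A *v els_solution A B b d - transpose B *v w = transpose A *v b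
            \<and> B *v els_solution A B b d = d"
proof -
  define M where "M = transpose A ** A"
  define N where "N = B ** matrix_inv M ** transpose B"
  define P where "P = transpose B ** matrix_inv N ** B ** matrix_inv M - mat 1"
  have iM: "invertible M" unfolding M_def by (rule gram_invertible[OF A])
  have iN: "invertible N" unfolding N_def M_def by (rule schur_invertible[OF A B])
  note inv = matrix_inv_cancel(1)[OF iM] matrix_inv_cancel(1)[OF iN]
  have tM: "transpose (matrix_inv M) = matrix_inv M"
    by (rule matrix_symmetric_inv[OF iM]) (simp add: M_def matrix_transpose_mul)
  have tN: "transpose (matrix_inv N) = matrix_inv N"
    by (rule matrix_symmetric_inv[OF iN]) (simp add: N_def matrix_transpose_mul tM matrix_mul_assoc)
  define c where "c = matrix_inv M *v (transpose A *v b)"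
  define w where "w = matrix_inv N *v (d - B *v c)"
  have "els_solution A B b d = matrix_inv M ** transpose B ** matrix_inv N *v d
                - transpose P ** matrix_inv M ** transpose A *v b"
    by (rule els_solution_eq(2)[OF A B M_def N_def P_def refl])
  also have "\<dots> = c + matrix_inv M *v (transpose B *v w)"
    by (simp add: P_def transpose_diff matrix_transpose_mul tM tN transpose_mat c_def w_def
        matrix_vector_mul_assoc[symmetric] matrix_vector_mult_diff_rdistrib matrix_vector_mult_diff_distrib)
  finally have sol: "els_solution A B b d = c + matrix_inv M *v (transpose B *v w)" .
  have Mc: "M *v (matrix_inv M *v v) = v" for v
    by (simp add: matrix_vector_mul_assoc inv)
  have "B *v (matrix_inv M *v (transpose B *v w)) = N *v w"
    by (simp add: N_def matrix_vector_mul_assoc[symmetric])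
  also have "N *v w = d - B *v c" by (simp add: w_def matrix_vector_mul_assoc inv)
  finally show ?thesis
    unfolding sol M_def[symmetric]
    by (intro exI[of _ w]) (simp add: matrix_vector_right_distrib Mc, simp add: c_def Mc)
qed

text \<open>Full row rank makes B B^T invertible, so applying (B B^T)^-1 B to the stationarity
  condition isolates the multiplier. This ties the explicit formula for the multiplier to the KKT
  system.\<close>

lemma els_multiplier_eq:
  fixes B :: "real^'n^'s"
  assumes B: "rank B = CARD('s)" and w: "transpose A *v r = - (transpose B *v w)"
  shows "w = - (matrix_inv (B ** transpose B) ** B ** transpose A *v r)"
proof -
  have "invertible (B ** transpose B)"
    using gram_invertible[of "transpose B"] B by (simp add: rank_transpose)
  note inv = matrix_inv_cancel(2)[OF this]
  have "matrix_inv (B ** transpose B) ** B ** transpose A *v r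
          = - (matrix_inv (B ** transpose B) *v (B *v (transpose B *v w)))"
    by (simp add: matrix_vector_mul_assoc[symmetric] w linear_neg)
  also have "\<dots> = - w"
    by (simp add: matrix_vector_mul_assoc inv flip: matrix_mul_assoc)
  finally show ?thesis by simp
qed

text \<open>\<open>implicit_linear_has_derivative\<close> is applied to the pair of solution and
  multiplier, and the first component of the result is kept.\<close>

lemma els_solution_has_derivative:
  fixes A :: "real^'n^'m" and B :: "real^'n^'s"
  assumes A: "rank A = CARD('n)" and B: "rank B = CARD('s)"
    and M: "M = transpose A ** A"
    and N: "N = B ** matrix_inv M ** transpose B"
    and P: "P = transpose B ** matrix_inv N ** B ** matrix_inv M - mat 1"
    and x: "x = els_solution A B b d"
    and r: "r = b - A *v x"
    and l: "transpose A *v r = - (transpose B *v l)"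
  shows "((\<lambda>(A', B', b', d'). els_solution A' B' b' d') has_derivative
      (\<lambda>(dA, dB, db, dd). matrix_inv M ** transpose B ** matrix_inv N *v (dd - dB *v x)
         - matrix_inv M ** P *v (transpose dA *v r - transpose A *v (dA *v x - db) + transpose dB *v l)))
      (at (A, B, b, d))"
proof -
  \<comment> \<open>The block matrix [[M, -B^T], [B, 0]] is encoded by the pair of \<open>M\<close>
    and \<open>B\<close>; its action is still bilinear because transposition is linear.\<close>
  define op :: "(real^'n^'n) \<times> (real^'n^'s) \<Rightarrow> (real^'n) \<times> (real^'s) \<Rightarrow> (real^'n) \<times> (real^'s)"
    where "op H z = (fst H *v fst z - transpose (snd H) *v snd z, snd H *v fst z)" for H z
  define H :: "(real^'n^'m) \<times> (real^'n^'s) \<times> (real^'m) \<times> (real^'s) \<Rightarrow> (real^'n^'n) \<times> (real^'n^'s)"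
    where "H u = (transpose (fst u) ** fst u, fst (snd u))" for u
  define H' :: "(real^'n^'m) \<times> (real^'n^'s) \<times> (real^'m) \<times> (real^'s) \<Rightarrow> (real^'n^'n) \<times> (real^'n^'s)"
    where "H' h = (transpose A ** fst h + transpose (fst h) ** A, fst (snd h))" for h
  define q :: "(real^'n^'m) \<times> (real^'n^'s) \<times> (real^'m) \<times> (real^'s) \<Rightarrow> (real^'n) \<times> (real^'s)"
    where "q u = (transpose (fst u) *v fst (snd (snd u)), snd (snd (snd u)))" for u
  define q' :: "(real^'n^'m) \<times> (real^'n^'s) \<times> (real^'m) \<times> (real^'s) \<Rightarrow> (real^'n) \<times> (real^'s)"
    where "q' h = (transpose A *v fst (snd (snd h)) + transpose (fst h) *v b, snd (snd (snd h)))" for h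
  define p where "p = (A, B, b, d)"
  define sol where "sol u = els_solution (fst u) (fst (snd u)) (fst (snd (snd u))) (snd (snd (snd u)))"
    for u :: "(real^'n^'m) \<times> (real^'n^'s) \<times> (real^'m) \<times> (real^'s)"
  \<comment> \<open>Where no multiplier exists, \<open>SOME\<close> yields an arbitrary value; at
    full rank data, hence near \<open>p\<close>, \<open>els_solution_kkt\<close> makes it a genuine
    one.\<close>
  define z where "z u = (sol u, SOME w. op (H u) (sol u, w) = q u)" for u
  define g where "g h = transpose (fst h) *v r - transpose A *v (fst h *v x - fst (snd (snd h)))
      + transpose (fst (snd h)) *v l" for h :: "(real^'n^'m) \<times> (real^'n^'s) \<times> (real^'m) \<times> (real^'s)"
  define k where "k h = snd (snd (snd h)) - fst (snd h) *v x"
    for h :: "(real^'n^'m) \<times> (real^'n^'s) \<times> (real^'m) \<times> (real^'s)"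
  \<comment> \<open>Block elimination for the linearised system with right-hand side
    \<open>(g h, k h)\<close>; \<open>N\<close> is the Schur complement that remains for the
    multiplier.\<close>
  define J where "J h = (matrix_inv M ** transpose B ** matrix_inv N *v k h - matrix_inv M ** P *v g h,
      matrix_inv N *v (k h - B *v (matrix_inv M *v g h)))" for h
  have iM: "invertible M" unfolding M by (rule gram_invertible[OF A])
  have iN: "invertible N" unfolding N M by (rule schur_invertible[OF A B])
  have MM: "M *v (matrix_inv M *v v) = v" for v
    by (simp add: matrix_vector_mul_assoc matrix_inv_cancel[OF iM])
  have NN: "B *v (matrix_inv M *v (transpose B *v (matrix_inv N *v v))) = v" for v
    using matrix_inv_cancel(1)[OF iN] by (simp add: matrix_vector_mul_assoc matrix_mul_assoc N)
  have op: "bounded_bilinear op"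
    by (simp add: bilinear_conv_bounded_bilinear[symmetric] bilinear_def linear_iff op_def
        algebra_simps scaleR_matrix_vector_assoc[symmetric] transpose_add transpose_scalar)
  have kkt_z: "op (H u) (z u) = q u"
    if "rank (fst u) = CARD('n)" "rank (fst (snd u)) = CARD('s)" for u
  proof -
    have "\<exists>w. op (H u) (sol u, w) = q u"
      using els_solution_kkt[OF that] by (simp add: op_def H_def q_def sol_def)
    then show ?thesis unfolding z_def by (rule someI_ex)
  qed
  have "eventually (\<lambda>u. rank (fst u) = CARD('n)) (nhds p)"
    by (rule eventually_full_col_rank[OF tendsto_fst[OF filterlim_ident]]) (simp add: p_def A)
  moreover have "eventually (\<lambda>u. rank (fst (snd u)) = CARD('s)) (nhds p)"
    by (rule eventually_full_row_rank[OF tendsto_fst[OF tendsto_snd[OF filterlim_ident]]]) (simp add: p_def B)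
  ultimately have ev: "eventually (\<lambda>u. op (H u) (z u) = q u) (nhds p)"
    by eventually_elim (rule kkt_z)
  have inj: "v = 0" if "op (H p) v = 0" for v
  proof -
    have 1: "M *v fst v = transpose B *v snd v" and 2: "B *v fst v = 0"
      using that by (auto simp: op_def H_def p_def M zero_prod_def)
    have 3: "fst v = matrix_inv M *v (transpose B *v snd v)"
      using matrix_inv_cancel(2)[OF iM] by (simp add: matrix_vector_mul_assoc flip: 1)
    then have "N *v snd v = 0" using 2 by (simp add: N flip: matrix_vector_mul_assoc)
    then have "snd v = 0" using matrix_inv_cancel(2)[OF iN]
      by (metis matrix_vector_mul_assoc matrix_vector_mul_lid matrix_vector_mult_0_right)
    with 3 show ?thesis by (simp add: prod_eq_iff)
  qed
  \<comment> \<open>The given \<open>l\<close> also solves the system at \<open>p\<close>, so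
    injectivity identifies it with the multiplier picked by \<open>SOME\<close>.\<close>
  have "op (H p) (x, l) = q p"
    using l els_solution_kkt[OF A B, of b d]
    by (auto simp: op_def H_def q_def p_def x r matrix_vector_mult_diff_distrib
        matrix_vector_mul_assoc[symmetric] algebra_simps)
  moreover have "op (H p) (z p) = q p" using A B by (intro kkt_z) (auto simp: p_def)
  ultimately have "op (H p) (z p - (x, l)) = 0"
    using bounded_bilinear.diff_right[OF op] by simp
  then have zp: "z p = (x, l)" using inj by fastforce
  have dH: "(H has_derivative H') (at p)"
    unfolding H_def H'_def
    by (rule derivative_eq_intros bounded_bilinear.FDERIV[OF bounded_bilinear_matrix_mult]
        bounded_linear.has_derivative[OF bounded_linear_transpose] refl | simp add: p_def)+
  have dq: "(q has_derivative q') (at p)"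
    unfolding q_def q'_def
    by (rule derivative_eq_intros bounded_bilinear.FDERIV[OF bounded_bilinear_matrix_vector_mult]
        bounded_linear.has_derivative[OF bounded_linear_transpose] refl | simp add: p_def)+
  have "(z has_derivative J) (at p)"
  proof (rule implicit_linear_has_derivative[OF op dH dq ev inj])
    fix h
    show "op (H p) (J h) = q' h - op (H' h) (z p)"
      by (simp add: op_def H_def J_def q'_def H'_def zp[unfolded p_def] p_def M[symmetric] P g_def k_def r
          matrix_vector_mul_assoc[symmetric] algebra_simps MM NN)
  qed
  then have "((\<lambda>u. fst (z u)) has_derivative (\<lambda>h. fst (J h))) (at p)"
    by (rule has_derivative_fst)
  then show ?thesis
    by (simp add: z_def sol_def J_def p_def g_def k_def split_def)
qed

section \<open>Outer products, block rows, and reduction to an operator norm\<close>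

lemma inner_transpose_left: "(transpose X *v u) \<bullet> v = u \<bullet> (X *v v)"
  for X :: "real^'n^'m"
  by (simp add: inner_transpose)

text \<open>Used to read off adjoints with respect to \<open>dA\<close> and \<open>dB\<close>: for
  the Frobenius inner product the representing matrix has rank one.\<close>

lemma inner_outer: "(X *v v) \<bullet> u = X \<bullet> outer u v"
  for X :: "real^'n^'m"
  by (simp add: inner_vec_def matrix_vector_mult_def outer_def sum_distrib_right sum_distrib_left ac_simps)

lemma outer_inner_outer: "outer u v \<bullet> outer u' v' = (u \<bullet> u') * (v \<bullet> v')"
  for v :: "real^'n" and u :: "real^'m"
  by (simp add: inner_vec_def outer_def sum_product ac_simps)

lemma outer_mult_vec: "outer u v *v y = (v \<bullet> y) *\<^sub>R u"
  for v :: "real^'n" and u :: "real^'m"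
  by (simp add: vec_eq_iff inner_vec_def outer_def matrix_vector_mult_def sum_distrib_right sum_distrib_left ac_simps)

lemma transpose_outer: "transpose (outer u v) = outer v u"
  by (simp add: transpose_def outer_def vec_eq_iff)

lemma norm_transpose_hcat:
  "(norm (transpose (U ||| V) *v y))\<^sup>2 = (norm (transpose U *v y))\<^sup>2 + (norm (transpose V *v y))\<^sup>2"
  for U :: "real^'a^'n" and V :: "real^'b^'n"
  unfolding power2_norm_eq_inner inner_vec_def UNIV_Plus_UNIV[symmetric]
  by (subst sum.Plus) (simp_all add: matrix_vector_mult_def transpose_def hcat_def)

lemma spectral_norm_transpose: "spectral_norm (transpose X) = spectral_norm X"
  for X :: "real^'n^'m"
  using onorm_adjoint[of "\<lambda>v. X *v v"] by (simp add: spectral_norm_def adjoint_matrix)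

lemma norm_Pair_power2: "(norm (a, b))\<^sup>2 = (norm a)\<^sup>2 + (norm b)\<^sup>2"
  by (simp add: norm_Pair)

lemma weighted_norm_eq_norm:
  "weighted_norm \<Phi> \<Psi> \<beta> \<theta> dA dB db dd = norm (\<Phi> *\<^sub>R dA, \<Psi> *\<^sub>R dB, \<beta> *\<^sub>R db, \<theta> *\<^sub>R dd)"
  by (simp add: weighted_norm_def norm_Pair power_mult_distrib add.assoc)

text \<open>With the weighted perturbation as variable the weighted norm becomes the norm of the
  product space, so \<open>ratio_Sup_tendsto_onorm\<close> applies; the weights return as inverse
  factors in the argument of the derivative.\<close>

lemma els_projected_cond_eq_onorm:
  fixes A :: "real^'n^'m" and B :: "real^'n^'s" and L :: "real^'k^'n"
  assumes pos: "\<Phi> > 0" "\<Psi> > 0" "\<beta> > 0" "\<theta> > 0" "\<xi> > 0"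
    and J: "((\<lambda>(A', B', b', d'). els_solution A' B' b' d') has_derivative J) (at (A, B, b, d))"
  shows "els_projected_cond \<Phi> \<Psi> \<beta> \<theta> \<xi> L A B b d
    = ereal (\<xi> * onorm (\<lambda>(dA, dB, db, dd).
        transpose L *v J (dA /\<^sub>R \<Phi>, dB /\<^sub>R \<Psi>, db /\<^sub>R \<beta>, dd /\<^sub>R \<theta>)))"
proof -
  define \<sigma> :: "(real^'n^'m) \<times> (real^'n^'s) \<times> (real^'m) \<times> (real^'s) \<Rightarrow> _"
    where "\<sigma> u = (fst u /\<^sub>R \<Phi>, fst (snd u) /\<^sub>R \<Psi>, fst (snd (snd u)) /\<^sub>R \<beta>, snd (snd (snd u)) /\<^sub>R \<theta>)" for u
  define sol where "sol = (\<lambda>(A' :: real^'n^'m, B' :: real^'n^'s, b', d'). els_solution A' B' b' d')"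
  define p where "p = (A, B, b, d)"
  define g where "g u = \<xi> *\<^sub>R (transpose L *v sol (p + \<sigma> u))" for u
  have "((\<lambda>u. p + \<sigma> u) has_derivative \<sigma>) (at 0)"
    unfolding \<sigma>_def by (rule derivative_eq_intros refl | simp)+
  moreover have "(sol has_derivative J) (at (p + \<sigma> 0))"
    using J by (simp add: sol_def p_def \<sigma>_def zero_prod_def)
  ultimately have "((\<lambda>u. sol (p + \<sigma> u)) has_derivative (\<lambda>u. J (\<sigma> u))) (at 0)"
    by (rule has_derivative_compose)
  then have dL: "((\<lambda>u. transpose L *v sol (p + \<sigma> u)) has_derivative (\<lambda>u. transpose L *v J (\<sigma> u))) (at 0)"
    by (rule bounded_linear.has_derivative[OF matrix_vector_mul_bounded_linear])
  then have "(g has_derivative (\<lambda>u. \<xi> *\<^sub>R (transpose L *v J (\<sigma> u)))) (at 0)"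
    unfolding g_def by (rule has_derivative_scaleR_right)
  note lim = ratio_Sup_tendsto_onorm[OF this]
  have "els_ratio_sup \<Phi> \<Psi> \<beta> \<theta> \<xi> L A B b d \<delta>
      = Sup {ereal (norm (g u - g 0) / norm u) | u. 0 < norm u \<and> norm u \<le> \<delta>}" for \<delta>
  proof -
    have \<sigma>_scale: "\<sigma> (\<Phi> *\<^sub>R dA, \<Psi> *\<^sub>R dB, \<beta> *\<^sub>R db, \<theta> *\<^sub>R dd) = (dA, dB, db, dd)" for dA dB db dd
      using pos by (simp add: \<sigma>_def)
    have g_scale: "norm (g (\<Phi> *\<^sub>R dA, \<Psi> *\<^sub>R dB, \<beta> *\<^sub>R db, \<theta> *\<^sub>R dd) - g 0)
        = \<xi> * norm (els_projected_solution L (A + dA) (B + dB) (b + db) (d + dd)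
                     - els_projected_solution L A B b d)" for dA dB db dd
      using pos
      by (simp add: g_def \<sigma>_scale p_def sol_def els_projected_solution_def
          flip: scaleR_diff_right) (simp add: \<sigma>_def zero_prod_def)
    \<comment> \<open>Positive weights make the rescaling surjective, so both suprema run over the
      same set of values.\<close>
    have rescale: "(\<exists>u. Q u) \<longleftrightarrow> (\<exists>dA dB db dd. Q (\<Phi> *\<^sub>R dA, \<Psi> *\<^sub>R dB, \<beta> *\<^sub>R db, \<theta> *\<^sub>R dd))"
      for Q :: "(real^'n^'m) \<times> (real^'n^'s) \<times> (real^'m) \<times> (real^'s) \<Rightarrow> bool"
    proof
      assume "\<exists>u. Q u"
      then obtain a b c d where "Q (a, b, c, d)" by auto
      then have "Q (\<Phi> *\<^sub>R (a /\<^sub>R \<Phi>), \<Psi> *\<^sub>R (b /\<^sub>R \<Psi>), \<beta> *\<^sub>R (c /\<^sub>R \<beta>), \<theta> *\<^sub>R (d /\<^sub>R \<theta>))"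
        using pos by simp
      then show "\<exists>dA dB db dd. Q (\<Phi> *\<^sub>R dA, \<Psi> *\<^sub>R dB, \<beta> *\<^sub>R db, \<theta> *\<^sub>R dd)" by blast
    qed blast
    show ?thesis
      unfolding els_ratio_sup_def rescale g_scale weighted_norm_eq_norm ..
  qed
  with lim have "(els_ratio_sup \<Phi> \<Psi> \<beta> \<theta> \<xi> L A B b d
      \<longlongrightarrow> ereal (onorm (\<lambda>u. \<xi> *\<^sub>R (transpose L *v J (\<sigma> u))))) (at_right 0)"
    by presburger
  then have "els_projected_cond \<Phi> \<Psi> \<beta> \<theta> \<xi> L A B b d
      = ereal (onorm (\<lambda>u. \<xi> *\<^sub>R (transpose L *v J (\<sigma> u))))"
    by (intro tendsto_unique[OF _ els_ratio_sup_tendsto]) auto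
  then show ?thesis
    using onorm_scaleR[OF has_derivative_bounded_linear[OF dL], of \<xi>] pos
    by (simp add: \<sigma>_def split_def)
qed

text \<open>The codomains may differ: below, one map takes values in the data space and the other in
  a coordinate space indexed by the blocks.\<close>

lemma onorm_cong_norm:
  assumes "\<And>y. (norm (f y))\<^sup>2 = (norm (g y))\<^sup>2"
  shows "onorm f = onorm g"
  using assms by (simp add: onorm_def)

section \<open>The adjoint of the derivative and its two closed forms\<close>

theorem theorem4p8:
  fixes A :: "real^'n^'m" and B :: "real^'n^'s" and b :: "real^'m" and d :: "real^'s"
    and L :: "real^'k^'n"
    and x :: "real^'n" and r :: "real^'m" and l :: "real^'s"
    and M P S W Px :: "real^'n^'n" and N :: "real^'s^'s"
    and Q :: "real^('m + 'n + 'n + 'n)^'n"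
    and \<Phi> \<Psi> \<beta> \<theta> \<xi> \<zeta> \<gamma> :: real
  assumes rank_A: "rank A = CARD('n)"
    and rank_B: "rank B = CARD('s)"
    and rank_L: "rank L = CARD('k)"
    and pos: "\<Phi> > 0" "\<Psi> > 0" "\<beta> > 0" "\<theta> > 0" "\<xi> > 0"
    and x: "is_els_solution A B b d x"
    and M: "M = transpose A ** A"
    and N: "N = B ** matrix_inv M ** transpose B"
    and P: "P = transpose B ** matrix_inv N ** B ** matrix_inv M - mat 1"
    and r: "r = b - A *v x"
    and l: "l = - (matrix_inv (B ** transpose B) ** B ** transpose A *v r)"
    and \<zeta>: "\<zeta> = sqrt (\<beta>\<^sup>2 * (norm x)\<^sup>2 + \<Phi>\<^sup>2)"
    and \<gamma>: "\<gamma> = sqrt (\<theta>\<^sup>2 * (norm x)\<^sup>2 + \<Psi>\<^sup>2)"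
    and S: "S = ((norm l)\<^sup>2 / \<Psi>\<^sup>2 + (norm r)\<^sup>2 / \<Phi>\<^sup>2) *\<^sub>R mat 1
                + (\<zeta>\<^sup>2 / (\<beta>\<^sup>2 * \<Phi>\<^sup>2)) *\<^sub>R (transpose A ** A)"
    and W: "W = matrix_inv M ** P ** S ** transpose P ** matrix_inv M
                + (1 / \<Psi>\<^sup>2) *\<^sub>R (matrix_inv M ** P ** outer x l ** matrix_inv N ** B ** matrix_inv M)
                + (1 / \<Psi>\<^sup>2) *\<^sub>R (matrix_inv M ** transpose B ** matrix_inv N ** outer l x
                                 ** transpose P ** matrix_inv M)
                + (\<gamma>\<^sup>2 / (\<Psi>\<^sup>2 * \<theta>\<^sup>2)) *\<^sub>R (matrix_inv M ** transpose B ** matrix_inv N ** matrix_inv N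
                                           ** B ** matrix_inv M)"
    and Px: "Px = mat 1 - (1 / (norm x)\<^sup>2) *\<^sub>R outer x x"
    and Q: "Q = (\<zeta> / (\<Phi> * \<beta>)) *\<^sub>R transpose A
                ||| (norm r / \<Phi>) *\<^sub>R mat 1
                ||| (norm l / \<gamma>) *\<^sub>R mat 1
                ||| (\<theta> * norm l * norm x / (\<gamma> * \<Psi>)) *\<^sub>R Px"
  shows "els_projected_cond \<Phi> \<Psi> \<beta> \<theta> \<xi> L A B b d
           = ereal (\<xi> * sqrt (spectral_norm (transpose L ** W ** L)))
       \<and> (x \<noteq> 0 \<longrightarrow>
         els_projected_cond \<Phi> \<Psi> \<beta> \<theta> \<xi> L A B b d
           = ereal (\<xi> * spectral_norm (transpose L **
               (matrix_inv M ** P ** Q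
                ||| (\<gamma> / (\<Psi> * \<theta>)) *\<^sub>R (matrix_inv M ** transpose B ** matrix_inv N)
                    + (\<theta> / (\<Psi> * \<gamma>)) *\<^sub>R (matrix_inv M ** P ** outer x l)))))"
proof -
  define K where "K = matrix_inv M ** P"
  define G where "G = matrix_inv M ** transpose B ** matrix_inv N"
  have iM: "invertible M" unfolding M by (rule gram_invertible[OF rank_A])
  have iN: "invertible N" unfolding N M by (rule schur_invertible[OF rank_A rank_B])
  have tM: "transpose (matrix_inv M) = matrix_inv M"
    by (rule matrix_symmetric_inv[OF iM]) (simp add: M matrix_transpose_mul)
  have tN: "transpose (matrix_inv N) = matrix_inv N"
    by (rule matrix_symmetric_inv[OF iN]) (simp add: N matrix_transpose_mul tM matrix_mul_assoc)
  have K_eq: "K *v v = G *v (B *v (matrix_inv M *v v)) - matrix_inv M *v v" for v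
    by (simp add: K_def P G_def matrix_vector_mul_assoc[symmetric] algebra_simps)
  have tG: "transpose G = matrix_inv N ** B ** matrix_inv M"
    by (simp add: G_def matrix_transpose_mul tM tN matrix_mul_assoc)
  \<comment> \<open>Both sides expand to M^-1 B^T N^-1 B M^-1 - M^-1, which is symmetric; hence
    \<open>K\<close> is its own transpose.\<close>
  have tP: "transpose P ** matrix_inv M = K"
    by (simp add: K_def P matrix_transpose_mul tM tN transpose_mat transpose_diff matrix_eq
        matrix_vector_mul_assoc[symmetric] algebra_simps)
  then have tK: "transpose K = K"
    by (simp add: K_def matrix_transpose_mul tM)
  \<comment> \<open>\<open>G\<close> is a right inverse of \<open>B\<close>, and K = (G B - I) M^-1,
    so \<open>B\<close> annihilates the range of \<open>K\<close>.\<close>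
  have BG: "B *v (G *v v) = v" for v
    using matrix_inv_cancel(1)[OF iN] by (simp add: G_def matrix_vector_mul_assoc matrix_mul_assoc N)
  have BK: "B *v (K *v v) = 0" for v
    by (simp add: K_eq matrix_vector_mult_diff_distrib BG)
  have x_sol: "x = els_solution A B b d"
    using x els_solution_eq[OF rank_A rank_B M N P refl] by metis
  obtain w where "transpose A *v r = - (transpose B *v w)"
    using els_solution_kkt[OF rank_A rank_B, of b d]
    by (auto simp: r x_sol matrix_vector_mult_diff_distrib matrix_vector_mul_assoc algebra_simps)
  with els_multiplier_eq[OF rank_B this] l have tAr: "transpose A *v r = - (transpose B *v l)"
    by simp
  have r_orth: "(A *v (K *v z)) \<bullet> r = 0" for z
    by (simp add: inner_transpose tAr inner_transpose[symmetric] BK)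

  define f where "f = (\<lambda>(dA, dB, db, dd). transpose L *v
      (G *v (dd /\<^sub>R \<theta> - (dB /\<^sub>R \<Psi>) *v x)
       - K *v (transpose (dA /\<^sub>R \<Phi>) *v r - transpose A *v ((dA /\<^sub>R \<Phi>) *v x - db /\<^sub>R \<beta>)
               + transpose (dB /\<^sub>R \<Psi>) *v l)))"
  have cond: "els_projected_cond \<Phi> \<Psi> \<beta> \<theta> \<xi> L A B b d = ereal (\<xi> * onorm f)"
    using els_projected_cond_eq_onorm[OF pos
        els_solution_has_derivative[OF rank_A rank_B M N P x_sol r tAr], where L = L]
    by (simp add: f_def K_def G_def split_def)
  have lin_f: "linear f"
    by (auto simp: linear_iff f_def transpose_add transpose_scalar scaleR_matrix_vector_assoc[symmetric]
        algebra_simps)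

  \<comment> \<open>The adjoint of \<open>f\<close> with the factor \<open>L\<close> split off. Its
    components represent the dependence on \<open>dA\<close>, \<open>dB\<close>, \<open>db\<close>
    and \<open>dd\<close>, each with its weight inverted.\<close>
  define g where "g z = ((outer (A *v (K *v z)) x - outer r (K *v z)) /\<^sub>R \<Phi>,
      - ((outer l (K *v z) + outer (transpose G *v z) x) /\<^sub>R \<Psi>),
      - ((A *v (K *v z)) /\<^sub>R \<beta>), (transpose G *v z) /\<^sub>R \<theta>)" for z
  have adj_f: "adjoint f = (\<lambda>y. g (L *v y))"
  proof (rule adjoint_unique, safe)
    fix dA dB db dd y
    show "f (dA, dB, db, dd) \<bullet> y = (dA, dB, db, dd) \<bullet> g (L *v y)"
      by (simp add: f_def g_def inner_transpose_left inner_transpose[of K] inner_transpose[of G] tK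
          transpose_scalar scaleR_matrix_vector_assoc[symmetric] inner_simps inner_outer[symmetric])
        (simp add: inner_commute algebra_simps)
  qed

  \<comment> \<open>The common value of three expressions: |g z|^2, z . W z, and the squared norm of
    the transposed block row at \<open>z\<close>.\<close>
  define \<rho> where "\<rho> z = ((norm l)\<^sup>2 / \<Psi>\<^sup>2 + (norm r)\<^sup>2 / \<Phi>\<^sup>2) * (norm (K *v z))\<^sup>2
      + \<zeta>\<^sup>2 / (\<beta>\<^sup>2 * \<Phi>\<^sup>2) * (norm (A *v (K *v z)))\<^sup>2
      + \<gamma>\<^sup>2 / (\<Psi>\<^sup>2 * \<theta>\<^sup>2) * (norm (transpose G *v z))\<^sup>2
      + 2 / \<Psi>\<^sup>2 * ((l \<bullet> (transpose G *v z)) * (x \<bullet> (K *v z)))" for z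
  have \<zeta>2: "\<zeta>\<^sup>2 = \<beta>\<^sup>2 * (norm x)\<^sup>2 + \<Phi>\<^sup>2" and \<gamma>2: "\<gamma>\<^sup>2 = \<theta>\<^sup>2 * (norm x)\<^sup>2 + \<Psi>\<^sup>2"
    by (simp_all add: \<zeta> \<gamma>)
  have g_sq: "(norm (g z))\<^sup>2 = \<rho> z" for z
  proof -
    define v where "v = K *v z"
    define h where "h = transpose G *v z"
    \<comment> \<open>The cross term contains (A v) . r and vanishes by \<open>r_orth\<close>; the
      one in the \<open>dB\<close> component below survives as the mixed term of
      \<open>\<rho>\<close>.\<close>
    have "(norm (outer (A *v v) x - outer r v))\<^sup>2
        = (norm (A *v v))\<^sup>2 * (norm x)\<^sup>2 + (norm r)\<^sup>2 * (norm v)\<^sup>2"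
      using r_orth[of z]
      by (simp add: v_def power2_norm_eq_inner inner_simps outer_inner_outer inner_commute)
    moreover have "(norm (outer l v + outer h x))\<^sup>2
        = (norm l)\<^sup>2 * (norm v)\<^sup>2 + (norm h)\<^sup>2 * (norm x)\<^sup>2 + 2 * ((l \<bullet> h) * (x \<bullet> v))"
      by (simp add: power2_norm_eq_inner inner_simps outer_inner_outer inner_commute)
    ultimately have "(norm (g z))\<^sup>2
        = ((norm (A *v v))\<^sup>2 * (norm x)\<^sup>2 + (norm r)\<^sup>2 * (norm v)\<^sup>2) / \<Phi>\<^sup>2
        + ((norm l)\<^sup>2 * (norm v)\<^sup>2 + (norm h)\<^sup>2 * (norm x)\<^sup>2 + 2 * ((l \<bullet> h) * (x \<bullet> v))) / \<Psi>\<^sup>2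
        + (norm (A *v v))\<^sup>2 / \<beta>\<^sup>2 + (norm h)\<^sup>2 / \<theta>\<^sup>2"
      unfolding g_def v_def[symmetric] h_def[symmetric]
      by (simp only: norm_Pair_power2 norm_minus_cancel norm_scaleR power_mult_distrib power2_abs
          power_inverse) (simp add: divide_inverse mult.commute)
    \<comment> \<open>\<open>dA\<close> and \<open>db\<close> both contribute multiples of |A v|^2,
      and \<open>dB\<close> and \<open>dd\<close> multiples of |h|^2; merging them produces
      \<open>\<zeta>\<close> and \<open>\<gamma>\<close>.\<close>
    moreover have "\<zeta>\<^sup>2 / (\<beta>\<^sup>2 * \<Phi>\<^sup>2) = (norm x)\<^sup>2 / \<Phi>\<^sup>2 + 1 / \<beta>\<^sup>2"
      "\<gamma>\<^sup>2 / (\<Psi>\<^sup>2 * \<theta>\<^sup>2) = (norm x)\<^sup>2 / \<Psi>\<^sup>2 + 1 / \<theta>\<^sup>2"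
      using pos by (simp_all add: \<zeta>2 \<gamma>2 field_simps)
    ultimately show ?thesis
      by (simp add: \<rho>_def v_def[symmetric] h_def[symmetric] add_divide_distrib algebra_simps)
  qed
  \<comment> \<open>In this form \<open>W\<close> is visibly symmetric: the two mixed terms are
    transposes of each other.\<close>
  have W_eq: "W = K ** S ** K + (1 / \<Psi>\<^sup>2) *\<^sub>R (K ** outer x l ** transpose G)
      + (1 / \<Psi>\<^sup>2) *\<^sub>R (G ** outer l x ** K) + (\<gamma>\<^sup>2 / (\<Psi>\<^sup>2 * \<theta>\<^sup>2)) *\<^sub>R (G ** transpose G)"
    unfolding W tG tP[symmetric] by (simp add: tP G_def K_def flip: matrix_mul_assoc)
  have tW: "transpose W = W"
    by (simp add: W_eq S transpose_add transpose_scalar matrix_transpose_mul tK transpose_outer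
        transpose_mat matrix_mul_assoc add_ac)
  have W_sq: "z \<bullet> (W *v z) = \<rho> z" for z
  proof -
    have G1: "z \<bullet> (G *v v) = (transpose G *v z) \<bullet> v" for v
      by (simp add: inner_transpose)
    have K1: "z \<bullet> (K *v v) = (K *v z) \<bullet> v" for v
      by (simp add: inner_transpose tK)
    define v where "v = K *v z"
    define h where "h = transpose G *v z"
    have "W *v z = K *v (S *v v) + ((l \<bullet> h) / \<Psi>\<^sup>2) *\<^sub>R (K *v x) + ((x \<bullet> v) / \<Psi>\<^sup>2) *\<^sub>R (G *v l)
        + (\<gamma>\<^sup>2 / (\<Psi>\<^sup>2 * \<theta>\<^sup>2)) *\<^sub>R (G *v h)"
      by (simp add: W_eq v_def h_def matrix_vector_mult_add_rdistrib scaleR_matrix_vector_assoc[symmetric]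
          outer_mult_vec matrix_vector_mult_scaleR flip: matrix_vector_mul_assoc)
    then have "z \<bullet> (W *v z) = v \<bullet> (S *v v) + (l \<bullet> h) / \<Psi>\<^sup>2 * (v \<bullet> x) + (x \<bullet> v) / \<Psi>\<^sup>2 * (h \<bullet> l)
        + \<gamma>\<^sup>2 / (\<Psi>\<^sup>2 * \<theta>\<^sup>2) * (h \<bullet> h)"
      by (simp add: inner_add_right G1 K1 flip: v_def h_def)
    moreover have "v \<bullet> (S *v v) = ((norm l)\<^sup>2 / \<Psi>\<^sup>2 + (norm r)\<^sup>2 / \<Phi>\<^sup>2) * (norm v)\<^sup>2
        + \<zeta>\<^sup>2 / (\<beta>\<^sup>2 * \<Phi>\<^sup>2) * (norm (A *v v))\<^sup>2"
      by (simp add: S matrix_vector_mult_add_rdistrib scaleR_matrix_vector_assoc[symmetric] inner_add_right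
          power2_norm_eq_inner flip: matrix_vector_mul_assoc inner_transpose)
    ultimately show ?thesis
      by (simp add: \<rho>_def inner_commute power2_norm_eq_inner flip: v_def h_def)
  qed

  \<comment> \<open>The quadratic form of L^T W L is |adjoint f y|^2, whence the square root in the
    first formula.\<close>
  have "spectral_norm (transpose L ** W ** L) = (onorm (adjoint f))\<^sup>2"
    unfolding spectral_norm_def
  proof (rule onorm_symmetric_square)
    show "bounded_linear (adjoint f)"
      using adjoint_linear[OF lin_f] by (simp add: linear_conv_bounded_linear)
    show "((transpose L ** W ** L) *v y) \<bullet> v = y \<bullet> ((transpose L ** W ** L) *v v)" for y v
      by (simp add: inner_transpose matrix_transpose_mul tW matrix_mul_assoc)
    show "(norm (adjoint f y))\<^sup>2 = y \<bullet> ((transpose L ** W ** L) *v y)" for y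
      by (simp add: adj_f g_sq flip: W_sq matrix_vector_mul_assoc) (simp add: inner_transpose)
  qed simp
  then have part1: "sqrt (spectral_norm (transpose L ** W ** L)) = onorm f"
    using onorm_pos_le[of f] lin_f by (simp add: onorm_adjoint linear_conv_bounded_linear)

  have part2: "spectral_norm (transpose L **
               (matrix_inv M ** P ** Q
                ||| (\<gamma> / (\<Psi> * \<theta>)) *\<^sub>R (matrix_inv M ** transpose B ** matrix_inv N)
                    + (\<theta> / (\<Psi> * \<gamma>)) *\<^sub>R (matrix_inv M ** P ** outer x l))) = onorm f"
    (is "spectral_norm (transpose L ** ?X) = _") if "x \<noteq> 0"
  proof -
    have \<gamma>0: "\<gamma> > 0" using pos by (simp add: \<gamma> add_nonneg_pos)
    have Px_sq: "(norm (transpose Px *v v))\<^sup>2 = (norm v)\<^sup>2 - (x \<bullet> v)\<^sup>2 / (norm x)\<^sup>2" for v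
    proof -
      define c where "c = (x \<bullet> v) / (norm x)\<^sup>2"
      have "transpose Px *v v = v - c *\<^sub>R x"
        by (simp add: Px c_def transpose_diff transpose_scalar transpose_outer transpose_mat
            matrix_vector_mult_diff_rdistrib scaleR_matrix_vector_assoc[symmetric] outer_mult_vec)
      then have "(norm (transpose Px *v v))\<^sup>2 = (norm v)\<^sup>2 - 2 * c * (x \<bullet> v) + c\<^sup>2 * (norm x)\<^sup>2"
        by (simp only: power2_norm_eq_inner)
          (simp add: inner_simps inner_commute power2_eq_square algebra_simps)
      then show ?thesis using that by (simp add: c_def power2_eq_square)
    qed
    have sq: "(norm (transpose ?X *v z))\<^sup>2 = \<rho> z" for z
    proof -
      define v where "v = K *v z"
      define h where "h = transpose G *v z"
      have "(norm (transpose ?X *v z))\<^sup>2 = (norm (transpose Q *v v))\<^sup>2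
          + (norm ((\<gamma> / (\<Psi> * \<theta>)) *\<^sub>R h + (\<theta> / (\<Psi> * \<gamma>)) *\<^sub>R ((x \<bullet> v) *\<^sub>R l)))\<^sup>2"
        unfolding norm_transpose_hcat K_def[symmetric] G_def[symmetric]
        by (simp add: matrix_transpose_mul tK transpose_add transpose_scalar transpose_outer
            matrix_vector_mult_add_rdistrib scaleR_matrix_vector_assoc[symmetric] v_def h_def outer_mult_vec
            flip: matrix_vector_mul_assoc)
      also have "(norm (transpose Q *v v))\<^sup>2 = (\<zeta> / (\<Phi> * \<beta>))\<^sup>2 * (norm (A *v v))\<^sup>2
          + (norm r / \<Phi>)\<^sup>2 * (norm v)\<^sup>2 + (norm l / \<gamma>)\<^sup>2 * (norm v)\<^sup>2
          + (\<theta> * norm l * norm x / (\<gamma> * \<Psi>))\<^sup>2 * ((norm v)\<^sup>2 - (x \<bullet> v)\<^sup>2 / (norm x)\<^sup>2)"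
        unfolding Q norm_transpose_hcat
        by (simp add: transpose_scalar transpose_mat scaleR_matrix_vector_assoc[symmetric] power_mult_distrib
            power_divide Px_sq del: norm_mult)
      also have "(norm ((\<gamma> / (\<Psi> * \<theta>)) *\<^sub>R h + (\<theta> / (\<Psi> * \<gamma>)) *\<^sub>R ((x \<bullet> v) *\<^sub>R l)))\<^sup>2
          = (\<gamma> / (\<Psi> * \<theta>))\<^sup>2 * (norm h)\<^sup>2 + 2 * ((\<gamma> / (\<Psi> * \<theta>)) * (\<theta> / (\<Psi> * \<gamma>))) * (x \<bullet> v) * (l \<bullet> h)
          + (\<theta> / (\<Psi> * \<gamma>))\<^sup>2 * (x \<bullet> v)\<^sup>2 * (norm l)\<^sup>2"
        unfolding power2_norm_eq_inner
        by (simp add: inner_simps inner_commute algebra_simps power2_eq_square)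
      also have "(\<gamma> / (\<Psi> * \<theta>)) * (\<theta> / (\<Psi> * \<gamma>)) = 1 / \<Psi>\<^sup>2"
        using pos \<gamma>0 by (simp add: field_simps power2_eq_square)
      \<comment> \<open>The terms with (x . v)^2 |l|^2 cancel: the projection \<open>Px\<close>
        subtracts exactly what the square of the last block adds.\<close>
      finally have expand: "(norm (transpose ?X *v z))\<^sup>2 = (norm r)\<^sup>2 / \<Phi>\<^sup>2 * (norm v)\<^sup>2
          + \<zeta>\<^sup>2 / (\<beta>\<^sup>2 * \<Phi>\<^sup>2) * (norm (A *v v))\<^sup>2
          + \<gamma>\<^sup>2 / (\<Psi>\<^sup>2 * \<theta>\<^sup>2) * (norm h)\<^sup>2 + 2 / \<Psi>\<^sup>2 * ((l \<bullet> h) * (x \<bullet> v))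
          + (norm l)\<^sup>2 * (norm v)\<^sup>2 * (1 / \<gamma>\<^sup>2 + \<theta>\<^sup>2 * (norm x)\<^sup>2 / (\<gamma>\<^sup>2 * \<Psi>\<^sup>2))"
        using that by (simp add: power_mult_distrib power_divide diff_divide_distrib algebra_simps)
      \<comment> \<open>By the definition of \<open>\<gamma>\<close>, the last two blocks of
        \<open>Q\<close> together supply the weight of |l|^2 |v|^2 required in
        \<open>\<rho>\<close>.\<close>
      have "1 / \<gamma>\<^sup>2 + \<theta>\<^sup>2 * (norm x)\<^sup>2 / (\<gamma>\<^sup>2 * \<Psi>\<^sup>2) = (\<Psi>\<^sup>2 + \<theta>\<^sup>2 * (norm x)\<^sup>2) / (\<gamma>\<^sup>2 * \<Psi>\<^sup>2)"
        using pos \<gamma>0 by (simp add: field_simps)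
      also have "\<dots> = 1 / \<Psi>\<^sup>2"
        using \<gamma>0 by (simp add: \<gamma>2[symmetric] add.commute[of "\<Psi>\<^sup>2"])
      finally show ?thesis
        unfolding expand \<rho>_def v_def[symmetric] h_def[symmetric] by (simp add: algebra_simps)
    qed
    \<comment> \<open>Passing to the transpose makes \<open>sq\<close> applicable at
      \<open>z = L *v y\<close>, where \<open>g_sq\<close> gives the same value for the adjoint of
      \<open>f\<close>.\<close>
    have "spectral_norm (transpose L ** ?X) = onorm (\<lambda>y. transpose (transpose L ** ?X) *v y)"
      by (metis spectral_norm_transpose spectral_norm_def)
    also have "\<dots> = onorm (adjoint f)"
      by (rule onorm_cong_norm)
        (simp add: adj_f g_sq matrix_transpose_mul sq flip: matrix_vector_mul_assoc)
    finally show ?thesis by (simp add: onorm_adjoint[OF lin_f])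
  qed
  show ?thesis using cond part1 part2 by simp
qed

end
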